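(* For every $\epsilon>0$ there exists $k=O(1/\epsilon^2)$ and a self-bounding function $f:\{0,1\}^k\to[0,1]$ such that $\mathsf{deg}^{\ell_2}_\epsilon(f)=\Omega(1/\epsilon^2)$.
   Context: A function $f:\{0,1\}^k\to\mathbb{R}$ is self-bounding if it is $1$-Lipschitz (with respect to Hamming distance) and for all $x$, $\sum_{i=1}^k(f(x)-f(x\oplus e_i))_+\le f(x)$, where $x\oplus e_i$ is $x$ with the $i$-th bit flipped and $(\alpha)_+=\max\{0,\alpha\}$. $\mathsf{deg}^{\ell_2}_\epsilon(f)$ is the smallest $d$ such that some real polynomial $p$ of degree $d$ satisfies $\sqrt{\mathbb{E}_x[(f(x)-p(x))^2]}\le\epsilon$, $x$ uniform on $\{0,1\}^k$. Implied constants are absolute.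
   Formalization: The claim is proved for 0 < ε < 1/2 instead of every ε > 0; for ε ≥ 1/2 it fails, since the constant 1/2 approximates every f into [0,1] within ε, so the degree is 0 and cannot be Ω(1/ε²) with an absolute constant. *)

theory Defs
  imports "HOL-Probability.Probability" "HOL-Library.Poly_Mapping"
begin

text \<open>Points of \<open>{0,1}\<^sup>k\<close> are real-valued, so that real polynomials can be evaluated at them directly.\<close>

definition cube :: "nat \<Rightarrow> (nat \<Rightarrow> real) set" where
  "cube k = ({..<k} \<rightarrow>\<^sub>E {0, 1})"

definition flip :: "(nat \<Rightarrow> real) \<Rightarrow> nat \<Rightarrow> nat \<Rightarrow> real" where
  "flip x i = x(i := 1 - x i)"

definition hamming_dist :: "nat \<Rightarrow> (nat \<Rightarrow> real) \<Rightarrow> (nat \<Rightarrow> real) \<Rightarrow> nat" where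
  "hamming_dist k x y = card {i \<in> {..<k}. x i \<noteq> y i}"

definition self_bounding :: "nat \<Rightarrow> ((nat \<Rightarrow> real) \<Rightarrow> real) \<Rightarrow> bool" where
  "self_bounding k f \<longleftrightarrow>
     (\<forall>x\<in>cube k. \<forall>y\<in>cube k. \<bar>f x - f y\<bar> \<le> real (hamming_dist k x y)) \<and>
     (\<forall>x\<in>cube k. (\<Sum>i<k. max 0 (f x - f (flip x i))) \<le> f x)"

text \<open>Real polynomials in variables indexed by \<open>nat\<close>: finitely supported maps from monomials
  (finitely supported exponent vectors) to coefficients.\<close>

type_synonym rpoly = "(nat \<Rightarrow>\<^sub>0 nat) \<Rightarrow>\<^sub>0 real"

definition poly_vars :: "rpoly \<Rightarrow> nat set" where
  "poly_vars p = (\<Union>m\<in>Poly_Mapping.keys p. Poly_Mapping.keys m)"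

definition monom_degree :: "(nat \<Rightarrow>\<^sub>0 nat) \<Rightarrow> nat" where
  "monom_degree m = (\<Sum>i\<in>Poly_Mapping.keys m. Poly_Mapping.lookup m i)"

text \<open>The zero polynomial gets degree 0.\<close>

definition total_degree :: "rpoly \<Rightarrow> nat" where
  "total_degree p = Max (insert 0 (monom_degree ` Poly_Mapping.keys p))"

definition eval_poly :: "rpoly \<Rightarrow> (nat \<Rightarrow> real) \<Rightarrow> real" where
  "eval_poly p x = (\<Sum>m\<in>Poly_Mapping.keys p. Poly_Mapping.lookup p m * (\<Prod>i\<in>Poly_Mapping.keys m. x i ^ Poly_Mapping.lookup m i))"

definition l2_dist :: "nat \<Rightarrow> ((nat \<Rightarrow> real) \<Rightarrow> real) \<Rightarrow> ((nat \<Rightarrow> real) \<Rightarrow> real) \<Rightarrow> real" where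
  "l2_dist k f g = sqrt (measure_pmf.expectation (pmf_of_set (cube k)) (\<lambda>x. (f x - g x)\<^sup>2))"

definition l2_degree :: "nat \<Rightarrow> real \<Rightarrow> ((nat \<Rightarrow> real) \<Rightarrow> real) \<Rightarrow> nat" where
  "l2_degree k \<epsilon> f =
     (LEAST d. \<exists>p. poly_vars p \<subseteq> {..<k} \<and> total_degree p = d \<and> l2_dist k f (eval_poly p) \<le> \<epsilon>)"

text \<open>For \<open>\<epsilon> \<ge> 1/2\<close> every function into \<open>[0,1]\<close> has \<open>l2_degree\<close> 0, since the constant 1/2 is within
  distance 1/2 of it. A lower bound \<open>\<Omega>(1/\<epsilon>\<^sup>2)\<close> is therefore possible only for \<open>\<epsilon> < 1/2\<close>.\<close>

end

theory Submission
  imports Defs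
begin

text \<open>
  Take \<open>k = n - 1\<close> with \<open>n = 2 ^ r\<close> and let \<open>f\<close> be the indicator of the complement of the Hamming
  code of length \<open>k\<close>. The code is perfect, so a point outside it has exactly one neighbour inside it,
  which makes \<open>f\<close> self-bounding. The nonconstant Fourier characters of \<open>f\<close> come from the dual
  (simplex) code, so each of them has degree exactly \<open>n / 2\<close>. Hence their sum
  \<open>h\<close>, which equals \<open>n - 1\<close> on the code and \<open>- 1\<close> off it, is orthogonal to all polynomials
  of degree below \<open>n / 2\<close>, and testing \<open>f - p\<close> against \<open>h\<close> with Cauchy--Schwarz gives
  \<open>E (f - p)\<^sup>2 \<ge> (n - 1) / n\<^sup>2 \<ge> 1 / (2 n)\<close>.
\<close>

section \<open>Polynomials on the cube\<close>

lemma finite_cube: "finite (cube k)"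
  unfolding cube_def by (intro finite_PiE) auto

lemma card_cube: "card (cube k) = 2 ^ k"
  unfolding cube_def by (subst card_PiE) (auto simp: numeral_2_eq_2)

lemma cube_cases: "x \<in> cube k \<Longrightarrow> i < k \<Longrightarrow> x i = 0 \<or> x i = 1"
  unfolding cube_def by (auto dest!: PiE_mem[where x = i])

lemma l2_dist_eq: "l2_dist k f g = sqrt ((\<Sum>x\<in>cube k. (f x - g x)\<^sup>2) / 2 ^ k)"
proof -
  have "cube k \<noteq> {}"
    using card_cube[of k] by (metis card.empty power_not_zero zero_neq_numeral)
  then show ?thesis
    unfolding l2_dist_def by (subst integral_pmf_of_set) (auto simp: finite_cube card_cube)
qed

lemma eval_poly_superset:
  assumes "finite S" "Poly_Mapping.keys p \<subseteq> S"
  shows "eval_poly p x = (\<Sum>m\<in>S. Poly_Mapping.lookup p m *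
    (\<Prod>i\<in>Poly_Mapping.keys m. x i ^ Poly_Mapping.lookup m i))"
  unfolding eval_poly_def using assms by (intro sum.mono_neutral_left) (auto simp: in_keys_iff)

lemma eval_poly_add: "eval_poly (p + q) x = eval_poly p x + eval_poly q x"
proof -
  let ?S = "Poly_Mapping.keys p \<union> Poly_Mapping.keys q"
  have "Poly_Mapping.keys (p + q) \<subseteq> ?S"
    by (rule Poly_Mapping.keys_add)
  then show ?thesis
    by (simp add: eval_poly_superset[of ?S] lookup_add distrib_right sum.distrib)
qed

lemma poly_vars_add: "poly_vars (p + q) \<subseteq> poly_vars p \<union> poly_vars q"
  unfolding poly_vars_def using Poly_Mapping.keys_add[of p q] by blast

section \<open>Multilinear polynomials and interpolation\<close>

lemma multilinear_monomial:
  assumes "finite T"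
  obtains p where "poly_vars p \<subseteq> T" "\<And>x. eval_poly p x = c * (\<Prod>i\<in>T. x i)"
proof -
  have "finite {i. of_bool (i \<in> T) \<noteq> (0::nat)}"
    using assms by simp
  then have lookup: "Poly_Mapping.lookup (Abs_poly_mapping (\<lambda>i. of_bool (i \<in> T))) i =
      (of_bool (i \<in> T) :: nat)" for i
    by (subst lookup_Abs_poly_mapping) auto
  define m :: "nat \<Rightarrow>\<^sub>0 nat" where "m = Abs_poly_mapping (\<lambda>i. of_bool (i \<in> T))"
  have keys: "Poly_Mapping.keys m = T"
    unfolding m_def by (auto simp: in_keys_iff lookup)
  show ?thesis
  proof (rule that)
    show "poly_vars (Poly_Mapping.single m c) \<subseteq> T"
      unfolding poly_vars_def using keys by (auto split: if_splits)
    show "eval_poly (Poly_Mapping.single m c) x = c * (\<Prod>i\<in>T. x i)" for x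
      by (subst eval_poly_superset[of "{m}"]) (auto simp: keys, simp add: m_def lookup)
  qed
qed

lemma multilinear_poly:
  assumes "finite \<S>" "\<And>T. T \<in> \<S> \<Longrightarrow> T \<subseteq> {..<k}"
  obtains p where "poly_vars p \<subseteq> {..<k}"
    "\<And>x. eval_poly p x = (\<Sum>T\<in>\<S>. c T * (\<Prod>i\<in>T. x i))"
  using assms
proof (induction \<S> arbitrary: thesis rule: finite_induct)
  case empty
  show ?case
    by (rule empty(1)[of 0]) (auto simp: poly_vars_def eval_poly_def)
next
  case (insert T \<S>)
  obtain p where p: "poly_vars p \<subseteq> {..<k}"
    "\<And>x. eval_poly p x = (\<Sum>T\<in>\<S>. c T * (\<Prod>i\<in>T. x i))"
    using insert.IH insert.prems(2) by blast
  have T: "T \<subseteq> {..<k}"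
    using insert.prems(2) by blast
  then have "finite T"
    using finite_subset by blast
  then obtain q where q: "poly_vars q \<subseteq> T" "\<And>x. eval_poly q x = c T * (\<Prod>i\<in>T. x i)"
    using multilinear_monomial by blast
  show ?case
  proof (rule insert.prems(1))
    show "poly_vars (q + p) \<subseteq> {..<k}"
      using poly_vars_add[of q p] p(1) q(1) T by blast
    show "eval_poly (q + p) x = (\<Sum>T\<in>insert T \<S>. c T * (\<Prod>i\<in>T. x i))" for x
      using insert.hyps by (simp add: eval_poly_add p(2) q(2))
  qed
qed

text \<open>Lagrange interpolation: on the cube the indicator of \<open>y\<close> is a product of
  linear factors, one per coordinate. Expanding that product over subsets \<open>T\<close> gives the
  multilinear coefficients \<open>c T\<close>. Its purpose is to show that approximating polynomials
  exist at all.\<close>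

lemma cube_interpolation:
  obtains p where "poly_vars p \<subseteq> {..<k}" "\<And>x. x \<in> cube k \<Longrightarrow> eval_poly p x = g x"
proof -
  define c where "c T = (\<Sum>y\<in>cube k. g y * ((\<Prod>i\<in>T. 2 * y i - 1) * (\<Prod>i\<in>{..<k} - T. 1 - y i)))" for T
  obtain p where p: "poly_vars p \<subseteq> {..<k}"
    "\<And>x. eval_poly p x = (\<Sum>T\<in>Pow {..<k}. c T * (\<Prod>i\<in>T. x i))"
    by (rule multilinear_poly[of "Pow {..<k}" k c]) auto
  have "eval_poly p x = g x" if x: "x \<in> cube k" for x
  proof -
    \<comment> \<open>the factor at \<open>i\<close> is 1 if \<open>x i = y i\<close> and 0 otherwise\<close>
    have delta: "(\<Prod>i<k. (2 * y i - 1) * x i + (1 - y i)) = of_bool (y = x)" if y: "y \<in> cube k" for y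
    proof (cases "y = x")
      case True
      then show ?thesis
        using cube_cases[OF x] by (auto intro!: prod.neutral)
    next
      case False
      then obtain i where i: "i < k" "y i \<noteq> x i"
        using x y unfolding cube_def by (metis PiE_ext lessThan_iff)
      then have "(2 * y i - 1) * x i + (1 - y i) = 0"
        using cube_cases[OF x i(1)] cube_cases[OF y i(1)] by auto
      then show ?thesis
        using False i(1) by (auto intro!: prod_zero)
    qed
    have "eval_poly p x = (\<Sum>T\<in>Pow {..<k}. \<Sum>y\<in>cube k.
        g y * ((\<Prod>i\<in>T. (2 * y i - 1) * x i) * (\<Prod>i\<in>{..<k} - T. 1 - y i)))"
      unfolding p(2) c_def by (simp add: sum_distrib_right sum_distrib_left prod.distrib mult_ac)
    also have "\<dots> = (\<Sum>y\<in>cube k. g y * (\<Prod>i<k. (2 * y i - 1) * x i + (1 - y i)))"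
      by (subst sum.swap) (simp add: prod_add sum_distrib_left)
    also have "\<dots> = (\<Sum>y\<in>cube k. if y = x then g y else 0)"
      by (intro sum.cong) (auto simp: delta)
    also have "\<dots> = g x"
      using x by (simp add: finite_cube)
    finally show ?thesis .
  qed
  with p(1) show ?thesis
    using that by blast
qed

section \<open>Degrees and lower bounds on \<open>l2_degree\<close>\<close>

lemma card_keys_le_monom_degree: "card (Poly_Mapping.keys m) \<le> monom_degree m"
proof -
  have "card (Poly_Mapping.keys m) = (\<Sum>i\<in>Poly_Mapping.keys m. 1)"
    by simp
  also have "\<dots> \<le> monom_degree m"
    unfolding monom_degree_def by (intro sum_mono) (simp add: in_keys_iff Suc_le_eq)
  finally show ?thesis .
qed

lemma monom_degree_le_total_degree: "m \<in> Poly_Mapping.keys p \<Longrightarrow> monom_degree m \<le> total_degree p"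
  unfolding total_degree_def by (intro Max_ge) auto

text \<open>A \<open>LEAST\<close> has its defining property only once some witness exists. Exact
  interpolation supplies one at distance 0, which is where \<open>0 \<le> \<epsilon>\<close>
  enters.\<close>

lemma le_l2_degree:
  assumes "0 \<le> \<epsilon>"
    and "\<And>p. poly_vars p \<subseteq> {..<k} \<Longrightarrow> l2_dist k f (eval_poly p) \<le> \<epsilon> \<Longrightarrow> d \<le> total_degree p"
  shows "d \<le> l2_degree k \<epsilon> f"
proof -
  let ?P = "\<lambda>d. \<exists>p. poly_vars p \<subseteq> {..<k} \<and> total_degree p = d \<and> l2_dist k f (eval_poly p) \<le> \<epsilon>"
  obtain p where "poly_vars p \<subseteq> {..<k}" "\<And>x. x \<in> cube k \<Longrightarrow> eval_poly p x = f x"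
    using cube_interpolation by blast
  then have "?P (total_degree p)"
    using assms(1) by (auto simp: l2_dist_eq)
  then have "?P (l2_degree k \<epsilon> f)"
    unfolding l2_degree_def by (rule LeastI)
  then show ?thesis
    using assms(2) by metis
qed

section \<open>The Hamming code\<close>

text \<open>Toggling a fixed \<open>a \<in> A\<close> changes the parity of
  \<open>A \<inter> X\<close>, so it injects the even sets into the odd ones. This is the weight
  bound for nonzero words of the simplex code.\<close>

lemma card_odd_Int_subsets:
  assumes "A \<subseteq> {..<r}" "A \<noteq> {}"
  shows "2 ^ r \<le> 2 * card {X \<in> Pow {..<r}. odd (card (A \<inter> X))}"
proof -
  obtain a where a: "a \<in> A" "a < r"
    using assms by blast
  let ?O = "{X \<in> Pow {..<r}. odd (card (A \<inter> X))}"
  let ?E = "{X \<in> Pow {..<r}. even (card (A \<inter> X))}"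
  define t where "t X = (if a \<in> X then X - {a} else insert a X)" for X
  have "t (t X) = X" for X
    unfolding t_def by auto
  then have "inj_on t ?E"
    by (metis injI inj_on_subset subset_UNIV)
  moreover have "t ` ?E \<subseteq> ?O"
  proof safe
    fix X assume X: "X \<subseteq> {..<r}" "even (card (A \<inter> X))"
    have fin: "finite (A \<inter> X)"
      using X(1) finite_subset by blast
    show "i < r" if "i \<in> t X" for i
      using that X(1) a(2) unfolding t_def by (auto split: if_splits)
    show False if "even (card (A \<inter> t X))"
    proof (cases "a \<in> X")
      case True
      then have "A \<inter> X = insert a (A \<inter> t X)" "a \<notin> A \<inter> t X"
        using a(1) unfolding t_def by auto
      then show False
        using X(2) that fin by (metis card_insert_disjoint even_Suc finite_insert)
    next
      case False
      then have "A \<inter> t X = insert a (A \<inter> X)"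
        using a(1) unfolding t_def by auto
      then show False
        using X(2) that fin False by simp
    qed
  qed
  ultimately have "card ?E \<le> card ?O"
    by (intro card_inj_on_le[where f = t]) auto
  moreover have "card ?E + card ?O = 2 ^ r"
  proof -
    have "card (?E \<union> ?O) = card ?E + card ?O"
      by (intro card_Un_disjoint) auto
    moreover have "?E \<union> ?O = Pow {..<r}"
      by auto
    ultimately show ?thesis
      by (simp add: card_Pow)
  qed
  ultimately show ?thesis
    by simp
qed

text \<open>\<open>B i\<close> is the support of the \<open>i\<close>-th column of the parity check matrix.\<close>

locale hamming_code =
  fixes r k :: nat and B :: "nat \<Rightarrow> nat set"
  assumes bij_B: "bij_betw B {..<k} (Pow {..<r} - {{}})"
begin

text \<open>The \<open>j\<close>-th syndrome bit in multiplicative form: \<open>1 - 2 * x i\<close>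
  turns the bits 0, 1 into 1, -1, so on the cube the value is 1 exactly when the \<open>j\<close>-th
  parity is even.\<close>

definition check :: "(nat \<Rightarrow> real) \<Rightarrow> nat \<Rightarrow> real" where
  "check x j = (\<Prod>i | i < k \<and> j \<in> B i. 1 - 2 * x i)"

definition code :: "(nat \<Rightarrow> real) set" where
  "code = {x. \<forall>j<r. check x j = 1}"

definition off_code :: "(nat \<Rightarrow> real) \<Rightarrow> real" where
  "off_code x = of_bool (x \<notin> code)"

text \<open>The function \<open>h\<close> of the proof idea. The product over \<open>A\<close> is
  the character of the sum modulo 2 of the parity checks in \<open>A\<close>, a nonzero word of the
  dual code.\<close>

definition char_sum :: "(nat \<Rightarrow> real) \<Rightarrow> real" where
  "char_sum x = (\<Sum>A\<in>Pow {..<r} - {{}}. \<Prod>j\<in>A. check x j)"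

lemma B_subset: "i < k \<Longrightarrow> B i \<subseteq> {..<r}"
  using bij_betwE[OF bij_B] by auto

lemma Suc_k: "Suc k = 2 ^ r"
  using bij_betw_same_card[OF bij_B] by (simp add: card_Diff_singleton card_Pow)

lemma check_cases:
  assumes "x \<in> cube k"
  shows "check x j = 1 \<or> check x j = - 1"
proof -
  have "\<bar>check x j\<bar> = 1"
    unfolding check_def abs_prod using cube_cases[OF assms] by (intro prod.neutral) fastforce
  then show ?thesis
    by linarith
qed

lemma check_flip:
  assumes "i < k"
  shows "check (flip x i) j = (if j \<in> B i then - check x j else check x j)"
proof -
  let ?S = "{i'. i' < k \<and> j \<in> B i'}"
  have rest: "(\<Prod>i'\<in>?S - {i}. 1 - 2 * flip x i i') = (\<Prod>i'\<in>?S - {i}. 1 - 2 * x i')"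
    by (intro prod.cong) (auto simp: flip_def)
  show ?thesis
  proof (cases "j \<in> B i")
    case True
    then have "i \<in> ?S"
      using assms by simp
    then have "check (flip x i) j = (1 - 2 * flip x i i) * (\<Prod>i'\<in>?S - {i}. 1 - 2 * x i')"
      "check x j = (1 - 2 * x i) * (\<Prod>i'\<in>?S - {i}. 1 - 2 * x i')"
      unfolding check_def by (simp_all add: prod.remove[of ?S i] rest)
    then show ?thesis
      using True by (simp add: flip_def algebra_simps)
  next
    case False
    then show ?thesis
      using rest by (simp add: check_def)
  qed
qed

text \<open>With the empty set included, the sum factors into the product of
  \<open>check x j + 1\<close>. All factors are 2 on the code, and some factor is 0 off it. The
  empty set accounts for the \<open>- 1\<close>.\<close>

lemma char_sum_eq:
  assumes "x \<in> cube k"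
  shows "char_sum x = 2 ^ r * of_bool (x \<in> code) - 1"
proof -
  have "(\<Sum>A\<in>Pow {..<r}. \<Prod>j\<in>A. check x j) = (\<Prod>j<r. check x j + 1)"
    by (simp add: prod_add)
  also have "\<dots> = 2 ^ r * of_bool (x \<in> code)"
  proof (cases "x \<in> code")
    case True
    then show ?thesis
      by (simp add: code_def)
  next
    case False
    then obtain j where "j < r" "check x j = - 1"
      using check_cases[OF assms] unfolding code_def by blast
    then show ?thesis
      using False by (auto intro!: prod_zero bexI[of _ j])
  qed
  finally show ?thesis
    unfolding char_sum_def by (simp add: sum_diff1)
qed

section \<open>The self-bounding property\<close>

lemma self_bounding_off_code: "self_bounding k off_code"
  unfolding self_bounding_def
proof (intro conjI ballI)
  fix x y assume x: "x \<in> cube k" and y: "y \<in> cube k"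
  show "\<bar>off_code x - off_code y\<bar> \<le> real (hamming_dist k x y)"
  proof (cases "x = y")
    case False
    then obtain i where "i < k" "x i \<noteq> y i"
      using x y unfolding cube_def by (metis PiE_ext lessThan_iff)
    then have "hamming_dist k x y \<noteq> 0"
      unfolding hamming_dist_def by auto
    then have "1 \<le> real (hamming_dist k x y)"
      by linarith
    moreover have "\<bar>off_code x - off_code y\<bar> \<le> 1"
      unfolding off_code_def by simp
    ultimately show ?thesis
      by linarith
  qed simp
next
  fix x assume x: "x \<in> cube k"
  show "(\<Sum>i<k. max 0 (off_code x - off_code (flip x i))) \<le> off_code x"
  proof (cases "x \<in> code")
    case True
    then show ?thesis
      by (simp add: off_code_def sum_nonpos)
  next
    case False
    let ?N = "{i. i < k \<and> flip x i \<in> code}"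
    \<comment> \<open>Off the code the sum counts the neighbours in the code. Flipping
      \<open>i\<close> negates exactly the checks in \<open>B i\<close>, so it lands in the code
      only if \<open>B i\<close> is the set of failed checks. As \<open>B\<close> is injective, at
      most one \<open>i\<close> qualifies.\<close>
    have B: "B i = {j. j < r \<and> check x j = - 1}" if "i \<in> ?N" for i
      using that check_flip[of i x] B_subset[of i] check_cases[OF x]
      unfolding code_def by (auto split: if_splits)
    have "i = i'" if "i \<in> ?N" "i' \<in> ?N" for i i'
      using that B[of i] B[of i'] bij_B by (auto simp: bij_betw_def inj_on_def)
    then have "card ?N \<le> 1"
      by (intro card_le_Suc0_iff_eq[THEN iffD2, folded One_nat_def]) auto
    moreover have "(\<Sum>i<k. max 0 (off_code x - off_code (flip x i))) = (\<Sum>i\<in>?N. 1)"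
      using False by (intro sum.mono_neutral_cong_right) (auto simp: off_code_def)
    ultimately show ?thesis
      using False by (simp add: off_code_def)
  qed
qed

section \<open>Orthogonality to polynomials of low degree\<close>

text \<open>The character of \<open>A\<close> involves the variables \<open>i\<close> with
  \<open>card (A \<inter> B i)\<close> odd. There are at least \<open>2 ^ r / 2\<close> of them,
  more than \<open>T\<close> can cover, and summing over the two values of an uncovered one gives 0.
  Only the number of variables of the monomial matters, so the exponents \<open>e\<close> are
  arbitrary.\<close>

lemma char_orthogonal_monomial:
  assumes A: "A \<subseteq> {..<r}" "A \<noteq> {}" and T: "T \<subseteq> {..<k}" "2 * card T < 2 ^ r"
  shows "(\<Sum>x\<in>cube k. (\<Prod>j\<in>A. check x j) * (\<Prod>i\<in>T. x i ^ e i)) = 0"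
proof -
  let ?odd = "{i. i < k \<and> odd (card (A \<inter> B i))}"
  \<comment> \<open>An odd intersection excludes the empty set, the only subset of
    \<open>{..<r}\<close> that is not a column.\<close>
  have "B ` ?odd = {X \<in> Pow {..<r}. odd (card (A \<inter> X))}"
  proof -
    have "X \<in> B ` ?odd" if "X \<subseteq> {..<r}" "odd (card (A \<inter> X))" for X
    proof -
      have "X \<noteq> {}"
        using that(2) by auto
      then have "X \<in> B ` {..<k}"
        using that(1) bij_B by (simp add: bij_betw_def)
      then show ?thesis
        using that(2) by auto
    qed
    then show ?thesis
      using B_subset by blast
  qed
  then have "card {X \<in> Pow {..<r}. odd (card (A \<inter> X))} \<le> card ?odd"
    using card_image_le[of ?odd B] by simp
  then have "card T < card ?odd"
    using card_odd_Int_subsets[OF A] T(2) by linarith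
  then obtain i0 where i0: "i0 < k" "odd (card (A \<inter> B i0))" "i0 \<notin> T"
    using card_mono[of T ?odd] T(1) finite_subset[OF T(1)] by fastforce
  \<comment> \<open>\<open>\<phi> i\<close> collects the contribution of coordinate
    \<open>i\<close>; since the summand separates, the sum over the cube becomes a product of sums
    over single bits.\<close>
  define \<phi> where "\<phi> i y = (1 - 2 * y) ^ card (A \<inter> B i) * (if i \<in> T then y ^ e i else 1)"
    for i and y :: real
  have "(\<Prod>j\<in>A. check x j) * (\<Prod>i\<in>T. x i ^ e i) = (\<Prod>i<k. \<phi> i (x i))" for x
  proof -
    have fin: "finite A"
      using A(1) finite_subset by blast
    have "(\<Prod>j\<in>A. check x j) = (\<Prod>j\<in>A. \<Prod>i<k. if j \<in> B i then 1 - 2 * x i else 1)"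
      unfolding check_def
      by (rule prod.cong[OF refl]) (simp add: prod.inter_filter[symmetric])
    also have "\<dots> = (\<Prod>i<k. \<Prod>j\<in>A. if j \<in> B i then 1 - 2 * x i else 1)"
      by (rule prod.swap)
    also have "\<dots> = (\<Prod>i<k. (1 - 2 * x i) ^ card (A \<inter> B i))"
      using fin by (simp add: prod.inter_restrict[symmetric])
    finally have "(\<Prod>j\<in>A. check x j) = (\<Prod>i<k. (1 - 2 * x i) ^ card (A \<inter> B i))" .
    moreover have "(\<Prod>i\<in>T. x i ^ e i) = (\<Prod>i<k. if i \<in> T then x i ^ e i else 1)"
      using T(1) by (simp add: prod.inter_restrict[symmetric] Int_absorb1)
    ultimately show ?thesis
      by (simp add: \<phi>_def prod.distrib)
  qed
  then have "(\<Sum>x\<in>cube k. (\<Prod>j\<in>A. check x j) * (\<Prod>i\<in>T. x i ^ e i)) = (\<Prod>i<k. \<Sum>y\<in>{0, 1}. \<phi> i y)"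
    unfolding cube_def by (simp only: prod_sum_PiE finite_lessThan finite.intros)
  \<comment> \<open>Here \<open>\<phi> i0 0 = 1\<close>, and \<open>\<phi> i0 1\<close> is an odd
    power of -1.\<close>
  moreover have "(\<Sum>y\<in>{0, 1}. \<phi> i0 y) = 0"
    using i0(2,3) by (simp add: \<phi>_def)
  ultimately show ?thesis
    using i0(1) by (auto intro!: prod_zero)
qed

lemma char_sum_orthogonal_monomial:
  assumes "T \<subseteq> {..<k}" "2 * card T < 2 ^ r"
  shows "(\<Sum>x\<in>cube k. char_sum x * (\<Prod>i\<in>T. x i ^ e i)) = 0"
  unfolding char_sum_def sum_distrib_right
  by (subst sum.swap) (use assms char_orthogonal_monomial in \<open>auto intro!: sum.neutral\<close>)

lemma char_sum_orthogonal_poly: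
  assumes "poly_vars p \<subseteq> {..<k}" "2 * total_degree p < 2 ^ r"
  shows "(\<Sum>x\<in>cube k. char_sum x * eval_poly p x) = 0"
proof -
  have "(\<Sum>x\<in>cube k. char_sum x * eval_poly p x) =
      (\<Sum>m\<in>Poly_Mapping.keys p. Poly_Mapping.lookup p m *
        (\<Sum>x\<in>cube k. char_sum x * (\<Prod>i\<in>Poly_Mapping.keys m. x i ^ Poly_Mapping.lookup m i)))"
    unfolding eval_poly_def sum_distrib_left by (subst sum.swap) (simp add: mult_ac)
  also have "\<dots> = 0"
  proof (intro sum.neutral ballI)
    fix m assume m: "m \<in> Poly_Mapping.keys p"
    have "Poly_Mapping.keys m \<subseteq> {..<k}"
      using m assms(1) unfolding poly_vars_def by blast
    moreover have "2 * card (Poly_Mapping.keys m) < 2 ^ r"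
      using assms(2) monom_degree_le_total_degree[OF m] card_keys_le_monom_degree[of m] by linarith
    ultimately show "Poly_Mapping.lookup p m *
        (\<Sum>x\<in>cube k. char_sum x * (\<Prod>i\<in>Poly_Mapping.keys m. x i ^ Poly_Mapping.lookup m i)) = 0"
      by (simp add: char_sum_orthogonal_monomial)
  qed
  finally show ?thesis .
qed

lemma sum_char_sum: "(\<Sum>x\<in>cube k. char_sum x) = 0"
  \<comment> \<open>The empty monomial is the constant 1.\<close>
  using char_sum_orthogonal_monomial[of "{}" "\<lambda>_. 0"] by simp

section \<open>The lower bound on the distance and the degree\<close>

lemma sum_char_sum_squared: "(\<Sum>x\<in>cube k. (char_sum x)\<^sup>2) = (2 ^ r - 1) * 2 ^ k"
proof -
  \<comment> \<open>On the cube \<open>char_sum\<close> takes only the values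
    \<open>2 ^ r - 1\<close> and \<open>- 1\<close>; this is the quadratic equation with these two
    roots.\<close>
  have "(char_sum x)\<^sup>2 = (2 ^ r - 1) + (2 ^ r - 2) * char_sum x" if "x \<in> cube k" for x
    using that by (cases "x \<in> code") (auto simp: char_sum_eq power2_eq_square algebra_simps)
  then have "(\<Sum>x\<in>cube k. (char_sum x)\<^sup>2) = (\<Sum>x\<in>cube k. (2 ^ r - 1) + (2 ^ r - 2) * char_sum x)"
    by simp
  also have "\<dots> = (2 ^ r - 1) * 2 ^ k"
    by (simp add: sum.distrib sum_distrib_left[symmetric] sum_char_sum card_cube)
  finally show ?thesis .
qed

lemma l2_dist_off_code_poly:
  assumes r: "1 \<le> r" and p: "poly_vars p \<subseteq> {..<k}" "2 * total_degree p < 2 ^ r"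
  shows "1 / (2 * 2 ^ r) \<le> (l2_dist k off_code (eval_poly p))\<^sup>2"
proof -
  define n :: real where "n = 2 ^ r"
  define D where "D x = off_code x - eval_poly p x" for x
  have n: "2 \<le> n"
    using power_increasing[OF r, of "2::real"] by (simp add: n_def)
  \<comment> \<open>This is \<open>off_code x = 1 - (char_sum x + 1) / n\<close> multiplied by
    \<open>char_sum x\<close>; it reduces the correlation to the two moments of
    \<open>char_sum\<close> already computed.\<close>
  have off: "off_code x * char_sum x = (1 - 1 / n) * char_sum x - (char_sum x)\<^sup>2 / n"
    if "x \<in> cube k" for x
    using that n by (cases "x \<in> code")
      (auto simp: off_code_def char_sum_eq n_def[symmetric] power2_eq_square field_simps)
  have "(\<Sum>x\<in>cube k. D x * char_sum x) =
      (\<Sum>x\<in>cube k. off_code x * char_sum x) - (\<Sum>x\<in>cube k. char_sum x * eval_poly p x)"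
    by (simp add: D_def left_diff_distrib sum_subtractf mult.commute[of "char_sum _"])
  also have "\<dots> = (\<Sum>x\<in>cube k. (1 - 1 / n) * char_sum x - (char_sum x)\<^sup>2 / n)"
    by (simp add: char_sum_orthogonal_poly[OF p] off)
  also have "\<dots> = - ((n - 1) * 2 ^ k) / n"
    by (simp add: sum_subtractf sum_distrib_left[symmetric] sum_divide_distrib[symmetric]
        sum_char_sum sum_char_sum_squared n_def)
  \<comment> \<open>Cauchy--Schwarz. The second moment of \<open>char_sum\<close> is the same
    quantity \<open>(n - 1) * 2 ^ k\<close> as in the correlation, so one factor cancels; it is
    positive since \<open>n \<ge> 2\<close>.\<close>
  finally have "((n - 1) * 2 ^ k)\<^sup>2 / n\<^sup>2 \<le> (\<Sum>x\<in>cube k. (D x)\<^sup>2) * ((n - 1) * 2 ^ k)"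
    using Cauchy_Schwarz_ineq_sum[of D char_sum "cube k"]
    by (simp add: sum_char_sum_squared n_def[symmetric] power_divide)
  then have "((n - 1) * 2 ^ k) / n\<^sup>2 * ((n - 1) * 2 ^ k) \<le> (\<Sum>x\<in>cube k. (D x)\<^sup>2) * ((n - 1) * 2 ^ k)"
    by (simp add: power2_eq_square mult_ac)
  then have "((n - 1) * 2 ^ k) / n\<^sup>2 \<le> (\<Sum>x\<in>cube k. (D x)\<^sup>2)"
    by (rule mult_right_le_imp_le) (use n in auto)
  then have "(n - 1) / n\<^sup>2 \<le> (\<Sum>x\<in>cube k. (D x)\<^sup>2) / 2 ^ k"
    by (simp add: field_simps)
  \<comment> \<open>Equivalent to \<open>n \<le> 2 * (n - 1)\<close>, that is, to
    \<open>n \<ge> 2\<close>.\<close>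
  moreover have "1 / (2 * n) \<le> (n - 1) / n\<^sup>2"
    using n by (simp add: field_simps power2_eq_square)
  moreover have "(l2_dist k off_code (eval_poly p))\<^sup>2 = (\<Sum>x\<in>cube k. (D x)\<^sup>2) / 2 ^ k"
    unfolding l2_dist_eq D_def by (simp add: sum_nonneg)
  ultimately show ?thesis
    by (simp add: n_def)
qed

lemma l2_degree_off_code:
  assumes "1 \<le> r" "0 \<le> \<epsilon>" "\<epsilon>\<^sup>2 < 1 / (2 * 2 ^ r)"
  shows "2 ^ (r - 1) \<le> l2_degree k \<epsilon> off_code"
proof (rule le_l2_degree[OF assms(2)])
  fix p assume p: "poly_vars p \<subseteq> {..<k}" "l2_dist k off_code (eval_poly p) \<le> \<epsilon>"
  have "0 \<le> l2_dist k off_code (eval_poly p)"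
    unfolding l2_dist_eq by (simp add: sum_nonneg)
  then have "(l2_dist k off_code (eval_poly p))\<^sup>2 \<le> \<epsilon>\<^sup>2"
    using p(2) by (intro power_mono)
  then have "\<not> 2 * total_degree p < 2 ^ r"
    using l2_dist_off_code_poly[OF assms(1) p(1)] assms(3) by linarith
  moreover have "(2::nat) ^ r = 2 * 2 ^ (r - 1)"
    using assms(1) by (simp add: power_eq_if)
  ultimately show "2 ^ (r - 1) \<le> total_degree p"
    by simp
qed

end

section \<open>Choice of the code length\<close>

lemma ex_hamming_code: "\<exists>B. hamming_code r (2 ^ r - 1) B"
proof -
  have "card (Pow {..<r} - {{}}) = 2 ^ r - 1"
    by (simp add: card_Diff_singleton card_Pow)
  then show ?thesis
    using ex_bij_betw_nat_finite[of "Pow {..<r} - {{}}"]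
    by (auto simp: hamming_code_def atLeast0LessThan)
qed

text \<open>\<open>Suc r\<close> is the least exponent whose power of two reaches \<open>y\<close>,
  and \<open>y > 2\<close> forces it to be at least 2. The left inequality is strict because the
  degree bound needs \<open>\<epsilon>\<^sup>2\<close> strictly below
  \<open>1 / (2 * 2 ^ r)\<close>.\<close>

lemma ex_power_of_two_between:
  fixes y :: real
  assumes "2 < y"
  obtains r where "1 \<le> r" "2 ^ r < y" "y \<le> 2 ^ Suc r"
proof -
  obtain N where "y < 2 ^ N"
    using real_arch_pow[of 2 y] by auto
  then have y: "y \<le> 2 ^ N"
    by simp
  define s where "s = (LEAST s. y \<le> 2 ^ s)"
  have s: "y \<le> 2 ^ s"
    unfolding s_def using y by (rule LeastI)
  have "\<not> s \<le> 1"
  proof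
    assume "s \<le> 1"
    then have "(2::real) ^ s \<le> 2 ^ 1"
      by (intro power_increasing) auto
    then show False
      using s assms by simp
  qed
  then obtain r where r: "s = Suc r" "1 \<le> r"
    by (cases s) auto
  have "\<not> y \<le> 2 ^ r"
    using r(1) not_less_Least[of r "\<lambda>s. y \<le> 2 ^ s"] unfolding s_def by simp
  then show ?thesis
    using that r s by auto
qed

theorem theorem6p13:
  "\<exists>c>0. \<exists>C>0. \<forall>\<epsilon>::real. 0 < \<epsilon> \<and> \<epsilon> < 1 / 2 \<longrightarrow>
     (\<exists>(k::nat) f. real k \<le> C / \<epsilon>\<^sup>2 \<and> f \<in> cube k \<rightarrow> {0..1} \<and> self_bounding k f \<and>
        c / \<epsilon>\<^sup>2 \<le> real (l2_degree k \<epsilon> f))"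
proof -
  \<comment> \<open>With \<open>n = 2 ^ r\<close> the largest power of two below
    \<open>1 / (2 * \<epsilon>\<^sup>2)\<close>, the length is \<open>k < n\<close>, whence
    \<open>C = 1 / 2\<close>. Also \<open>n \<ge> 1 / (4 * \<epsilon>\<^sup>2)\<close> and the
    degree is at least \<open>n / 2\<close>, whence \<open>c = 1 / 8\<close>.\<close>
  have "\<exists>(k::nat) f. real k \<le> (1 / 2) / \<epsilon>\<^sup>2 \<and> f \<in> cube k \<rightarrow> {0..1} \<and> self_bounding k f \<and>
      (1 / 8) / \<epsilon>\<^sup>2 \<le> real (l2_degree k \<epsilon> f)" if \<epsilon>: "0 < \<epsilon>" "\<epsilon> < 1 / 2" for \<epsilon> :: real
  proof -
    have "\<epsilon>\<^sup>2 < (1 / 2)\<^sup>2"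
      using \<epsilon> by (intro power_strict_mono) auto
    \<comment> \<open>The bound \<open>\<epsilon> < 1 / 2\<close> is exactly what leaves room for a
      code with \<open>r \<ge> 1\<close>.\<close>
    then have "2 < 1 / (2 * \<epsilon>\<^sup>2)"
      using \<epsilon> by (simp add: field_simps power2_eq_square)
    then obtain r where r: "1 \<le> r" "2 ^ r < 1 / (2 * \<epsilon>\<^sup>2)" "1 / (2 * \<epsilon>\<^sup>2) \<le> 2 ^ Suc r"
      by (rule ex_power_of_two_between)
    define k :: nat where "k = 2 ^ r - 1"
    obtain B where "hamming_code r k B"
      using ex_hamming_code unfolding k_def by blast
    then interpret hamming_code r k B .
    have "real k + 1 = 2 ^ r"
      using Suc_k by (metis Suc_eq_plus1 of_nat_1 of_nat_add of_nat_numeral of_nat_power)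
    then have "real k \<le> (1 / 2) / \<epsilon>\<^sup>2"
      using r(2) by simp
    moreover have "off_code \<in> cube k \<rightarrow> {0..1}"
      by (simp add: off_code_def)
    moreover have "self_bounding k off_code"
      by (rule self_bounding_off_code)
    moreover have "(1 / 8) / \<epsilon>\<^sup>2 \<le> real (l2_degree k \<epsilon> off_code)"
    proof -
      have "\<epsilon>\<^sup>2 < 1 / (2 * 2 ^ r)"
        using r(2) \<epsilon> by (simp add: field_simps)
      then have "2 ^ (r - 1) \<le> l2_degree k \<epsilon> off_code"
        using r(1) \<epsilon> by (intro l2_degree_off_code) auto
      then have "2 ^ (r - 1) \<le> real (l2_degree k \<epsilon> off_code)"
        by (metis of_nat_le_iff of_nat_numeral of_nat_power)
      moreover have "(2::real) ^ Suc r = 4 * 2 ^ (r - 1)"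
        using r(1) by (simp add: power_eq_if)
      ultimately have "1 / (2 * \<epsilon>\<^sup>2) \<le> 4 * real (l2_degree k \<epsilon> off_code)"
        using r(3) by linarith
      then show ?thesis
        using \<epsilon> by (simp add: field_simps)
    qed
    ultimately show ?thesis
      by blast
  qed
  then show ?thesis
    by (intro exI[of _ "1 / 8"] exI[of _ "1 / 2"] conjI allI impI) auto
qed

end
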